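(* Let the symbol $\int_a^b$ denote throughout one fixed choice among the Kurzweil-Stieltjes, Young and Dushnik integrals; the following holds for each of these three choices. Let $f,g:[a,b]\to\mathbb{R}$ and $f_n:[a,b]\to\mathbb{R}$, $n\in\mathbb{N}$, be such that the integrals $\int_a^b f_n\,\mathrm{d}g$ exist for all $n\in\mathbb{N}$. Suppose that at least one of the following conditions is satisfied: (i) $g$ has bounded variation on $[a,b]$ and $f_n\to f$ uniformly on $[a,b]$; (ii) $g$ is bounded on $[a,b]$ and $\lim_{n\to\infty}\|f_n-f\|_{BV}=0$. Then the integral $\int_a^b f\,\mathrm{d}g$ exists as well, and $$\lim_{n\to\infty}\int_a^b f_n\,\mathrm{d}g=\int_a^b f\,\mathrm{d}g .$$
   Context: Here $-\infty<a<b<\infty$. A function $h:[a,b]\to\mathbb{R}$ is regulated if it has finite one-sided limits $h(t-)=\lim_{\tau\to t-}h(\tau)$ for all $t\in(a,b]$ and $h(s+)=\lim_{\tau\to s+}h(\tau)$ for all $s\in[a,b)$. For regulated $h$ put $\Delta^-h(t)=h(t)-h(t-)$ for $t\in(a,b]$ and $\Delta^+h(s)=h(s+)-h(s)$ for $s\in[a,b)$. The symbol $\mathrm{var}_a^b\,h\in[0,\infty]$ is the total variation of $h$ on $[a,b]$, and $\|h\|_{BV}=|h(a)|+\mathrm{var}_a^b\,h$. A division of $[a,b]$ is a finite sequence $\alpha=\{\alpha_0,\dots,\alpha_\nu\}$ with $a=\alpha_0<\alpha_1<\dots<\alpha_\nu=b$. A partition of $[a,b]$ is a pair $P=(\alpha,\xi)$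 where $\alpha$ is a division of $[a,b]$ and $\xi=\{\xi_1,\dots,\xi_\nu\}$ satisfies $\xi_j\in[\alpha_{j-1},\alpha_j]$ for all $j$. For divisions, $\alpha\supset\beta$ means inclusion of the sets of points. For $f,g:[a,b]\to\mathbb{R}$ and a partition $P=(\alpha,\xi)$ put $$S(f,\mathrm{d}g,P)=\sum_{j=1}^{\nu}f(\xi_j)\,[g(\alpha_j)-g(\alpha_{j-1})],$$ and, if $g$ is regulated, $$S_Y(f,\mathrm{d}g,P)=\sum_{j=1}^{\nu}\Big(f(\alpha_{j-1})\,\Delta^+g(\alpha_{j-1})+f(\xi_j)\,[g(\alpha_j-)-g(\alpha_{j-1}+)]+f(\alpha_j)\,\Delta^-g(\alpha_j)\Big).$$ Young integral and Dushnik integral: $(\mathrm{Y})\int_a^b f\,\mathrm{d}g$ (respectively $(\mathrm{D})\int_a^b f\,\mathrm{d}g$) exists and equals $I\in\mathbb{R}$ if for every $\varepsilon>0$ there is a division $\alpha_\varepsilon$ of $[a,b]$ such that $|S_Y(f,\mathrm{d}g,P)-I|<\varepsilon$ (respectively $|S(f,\mathrm{d}g,P)-I|<\varepsilon$) for all partitions $P=(\alpha,\xi)$ of $[a,b]$ with $\alpha\supset\alpha_\varepsilon$ and $\alpha_{j-1}<\xi_j<\alpha_j$ for all $j$. The Young integral is defined only for regulated integrators $g$; the assumption that a Young integral with respect to $g$ exists includes the assumption that $g$ is regulated. Kurzweil-Stieltjes integral: $(\mathrm{K})\int_a^b f\,\mathrm{d}g$ exists and equals $I\in\mathbb{R}$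 if for every $\varepsilon>0$ there is a function $\delta_\varepsilon:[a,b]\to(0,1)$ such that $|S(f,\mathrm{d}g,P)-I|<\varepsilon$ for all partitions $P=(\alpha,\xi)$ of $[a,b]$ with $[\alpha_{j-1},\alpha_j]\subset[\xi_j-\delta_\varepsilon(\xi_j),\xi_j+\delta_\varepsilon(\xi_j)]$ for all $j$. *)

theory Defs
  imports "HOL-Analysis.Analysis"
begin

text \<open>Functions on \<open>[a,b]\<close> are rendered as total functions \<open>real \<Rightarrow> real\<close>; for \<open>a < b\<close>, no notion
  below depends on their values outside \<open>{a..b}\<close>.\<close>

definition regulated :: "real \<Rightarrow> real \<Rightarrow> (real \<Rightarrow> real) \<Rightarrow> bool" where
  "regulated a b h \<longleftrightarrow>
     (\<forall>t\<in>{a<..b}. \<exists>l. (h \<longlongrightarrow> l) (at_left t)) \<and>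
     (\<forall>s\<in>{a..<b}. \<exists>l. (h \<longlongrightarrow> l) (at_right s))"

definition left_lim :: "(real \<Rightarrow> real) \<Rightarrow> real \<Rightarrow> real" where
  "left_lim h t = Lim (at_left t) h"

definition right_lim :: "(real \<Rightarrow> real) \<Rightarrow> real \<Rightarrow> real" where
  "right_lim h s = Lim (at_right s) h"

definition left_jump :: "(real \<Rightarrow> real) \<Rightarrow> real \<Rightarrow> real" where
  "left_jump h t = h t - left_lim h t"

definition right_jump :: "(real \<Rightarrow> real) \<Rightarrow> real \<Rightarrow> real" where
  "right_jump h s = right_lim h s - h s"

text \<open>A division with \<open>\<nu>\<close> subintervals is given by \<open>\<nu>\<close> and the values \<open>\<alpha> 0, \<dots>, \<alpha> \<nu>\<close>; values of
  \<open>\<alpha>\<close> beyond \<open>\<nu>\<close> are irrelevant. Tags are indexed from 0: \<open>\<xi> j\<close>, for \<open>j < \<nu>\<close>, is the tag of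
  \<open>{\<alpha> j..\<alpha> (Suc j)}\<close>.\<close>

definition division :: "real \<Rightarrow> real \<Rightarrow> nat \<Rightarrow> (nat \<Rightarrow> real) \<Rightarrow> bool" where
  "division a b \<nu> \<alpha> \<longleftrightarrow> \<alpha> 0 = a \<and> \<alpha> \<nu> = b \<and> (\<forall>j<\<nu>. \<alpha> j < \<alpha> (Suc j))"

definition tagged_partition ::
    "real \<Rightarrow> real \<Rightarrow> nat \<Rightarrow> (nat \<Rightarrow> real) \<Rightarrow> (nat \<Rightarrow> real) \<Rightarrow> bool" where
  "tagged_partition a b \<nu> \<alpha> \<xi> \<longleftrightarrow>
     division a b \<nu> \<alpha> \<and> (\<forall>j<\<nu>. \<xi> j \<in> {\<alpha> j..\<alpha> (Suc j)})"

definition total_variation :: "real \<Rightarrow> real \<Rightarrow> (real \<Rightarrow> real) \<Rightarrow> ennreal" where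
  "total_variation a b h =
     (SUP (\<nu>, \<alpha>) \<in> {(\<nu>, \<alpha>). division a b \<nu> \<alpha>}. \<Sum>j<\<nu>. ennreal \<bar>h (\<alpha> (Suc j)) - h (\<alpha> j)\<bar>)"

definition bv_norm :: "real \<Rightarrow> real \<Rightarrow> (real \<Rightarrow> real) \<Rightarrow> ennreal" where
  "bv_norm a b h = ennreal \<bar>h a\<bar> + total_variation a b h"

definition stieltjes_sum ::
    "(real \<Rightarrow> real) \<Rightarrow> (real \<Rightarrow> real) \<Rightarrow> nat \<Rightarrow> (nat \<Rightarrow> real) \<Rightarrow> (nat \<Rightarrow> real) \<Rightarrow> real" where
  "stieltjes_sum f g \<nu> \<alpha> \<xi> = (\<Sum>j<\<nu>. f (\<xi> j) * (g (\<alpha> (Suc j)) - g (\<alpha> j)))"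

definition young_sum ::
    "(real \<Rightarrow> real) \<Rightarrow> (real \<Rightarrow> real) \<Rightarrow> nat \<Rightarrow> (nat \<Rightarrow> real) \<Rightarrow> (nat \<Rightarrow> real) \<Rightarrow> real" where
  "young_sum f g \<nu> \<alpha> \<xi> =
     (\<Sum>j<\<nu>. f (\<alpha> j) * right_jump g (\<alpha> j)
           + f (\<xi> j) * (left_lim g (\<alpha> (Suc j)) - right_lim g (\<alpha> j))
           + f (\<alpha> (Suc j)) * left_jump g (\<alpha> (Suc j)))"

definition has_kurzweil_integral ::
    "(real \<Rightarrow> real) \<Rightarrow> (real \<Rightarrow> real) \<Rightarrow> real \<Rightarrow> real \<Rightarrow> real \<Rightarrow> bool" where
  "has_kurzweil_integral f g a b I \<longleftrightarrow>
     (\<forall>\<epsilon>>0. \<exists>\<delta> :: real \<Rightarrow> real. (\<forall>x\<in>{a..b}. \<delta> x \<in> {0<..<1}) \<and>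
        (\<forall>\<nu> \<alpha> \<xi>. tagged_partition a b \<nu> \<alpha> \<xi> \<and>
           (\<forall>j<\<nu>. {\<alpha> j..\<alpha> (Suc j)} \<subseteq> {\<xi> j - \<delta> (\<xi> j)..\<xi> j + \<delta> (\<xi> j)}) \<longrightarrow>
           \<bar>stieltjes_sum f g \<nu> \<alpha> \<xi> - I\<bar> < \<epsilon>))"

definition has_dushnik_integral ::
    "(real \<Rightarrow> real) \<Rightarrow> (real \<Rightarrow> real) \<Rightarrow> real \<Rightarrow> real \<Rightarrow> real \<Rightarrow> bool" where
  "has_dushnik_integral f g a b I \<longleftrightarrow>
     (\<forall>\<epsilon>>0. \<exists>\<mu> \<beta>. division a b \<mu> \<beta> \<and>
        (\<forall>\<nu> \<alpha> \<xi>. tagged_partition a b \<nu> \<alpha> \<xi> \<and> \<beta> ` {..\<mu>} \<subseteq> \<alpha> ` {..\<nu>} \<and>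
           (\<forall>j<\<nu>. \<alpha> j < \<xi> j \<and> \<xi> j < \<alpha> (Suc j)) \<longrightarrow>
           \<bar>stieltjes_sum f g \<nu> \<alpha> \<xi> - I\<bar> < \<epsilon>))"

definition has_young_integral ::
    "(real \<Rightarrow> real) \<Rightarrow> (real \<Rightarrow> real) \<Rightarrow> real \<Rightarrow> real \<Rightarrow> real \<Rightarrow> bool" where
  "has_young_integral f g a b I \<longleftrightarrow>
     regulated a b g \<and>
     (\<forall>\<epsilon>>0. \<exists>\<mu> \<beta>. division a b \<mu> \<beta> \<and>
        (\<forall>\<nu> \<alpha> \<xi>. tagged_partition a b \<nu> \<alpha> \<xi> \<and> \<beta> ` {..\<mu>} \<subseteq> \<alpha> ` {..\<nu>} \<and>
           (\<forall>j<\<nu>. \<alpha> j < \<xi> j \<and> \<xi> j < \<alpha> (Suc j)) \<longrightarrow>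
           \<bar>young_sum f g \<nu> \<alpha> \<xi> - I\<bar> < \<epsilon>))"

datatype integral_kind = Kurzweil | Young | Dushnik

fun has_stieltjes_integral ::
    "integral_kind \<Rightarrow> (real \<Rightarrow> real) \<Rightarrow> (real \<Rightarrow> real) \<Rightarrow> real \<Rightarrow> real \<Rightarrow> real \<Rightarrow> bool" where
  "has_stieltjes_integral Kurzweil f g a b I = has_kurzweil_integral f g a b I"
| "has_stieltjes_integral Young f g a b I = has_young_integral f g a b I"
| "has_stieltjes_integral Dushnik f g a b I = has_dushnik_integral f g a b I"

definition stieltjes_integrable ::
    "integral_kind \<Rightarrow> (real \<Rightarrow> real) \<Rightarrow> (real \<Rightarrow> real) \<Rightarrow> real \<Rightarrow> real \<Rightarrow> bool" where
  "stieltjes_integrable k f g a b \<longleftrightarrow> (\<exists>I. has_stieltjes_integral k f g a b I)"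

definition stieltjes_integral ::
    "integral_kind \<Rightarrow> (real \<Rightarrow> real) \<Rightarrow> (real \<Rightarrow> real) \<Rightarrow> real \<Rightarrow> real \<Rightarrow> real" where
  "stieltjes_integral k f g a b = (THE I. has_stieltjes_integral k f g a b I)"

end

theory Submission
  imports Defs
begin

text \<open>Each of the three integrals is a limit of sums linear in the integrand, along a proper filter of
  tagged partitions. Sums against a fixed integrator are bounded uniformly in the partition: by
  \<open>sup \<bar>h\<bar> * var g\<close>, or, after summation by parts, by \<open>2 * sup \<bar>g\<bar> * \<parallel>h\<parallel>\<^sub>B\<^sub>V\<close>; Young sums inherit both
  bounds because they are limits of Riemann-Stieltjes sums. So under (i) or (ii) the sums for \<open>f\<^sub>n\<close>
  converge to those for \<open>f\<close> uniformly over partitions, and the two limits can be interchanged.\<close>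

section \<open>Divisions and total variation\<close>

lemma division_less:
  assumes "division a b \<nu> \<alpha>" "i < j" "j \<le> \<nu>"
  shows "\<alpha> i < \<alpha> j"
  using assms(2,3)
proof (induction j)
  case (Suc j)
  have "\<alpha> j < \<alpha> (Suc j)"
    using assms(1) Suc.prems by (auto simp: division_def)
  then show ?case
    using Suc by (cases "i = j") auto
qed simp

lemma division_in_Icc:
  assumes "division a b \<nu> \<alpha>" "j \<le> \<nu>"
  shows "\<alpha> j \<in> {a..b}"
proof -
  have "\<alpha> 0 \<le> \<alpha> j" "\<alpha> j \<le> \<alpha> \<nu>"
    using division_less[OF assms(1), of 0 j] division_less[OF assms(1), of j \<nu>] assms(2)
    by (cases "j = 0"; cases "j = \<nu>"; force)+
  then show ?thesis
    using assms(1) by (auto simp: division_def)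
qed

lemma tagged_partition_tag_in_Icc:
  assumes "tagged_partition a b \<nu> \<alpha> \<xi>" "j < \<nu>"
  shows "\<xi> j \<in> {a..b}"
proof -
  have "\<alpha> j \<in> {a..b}" "\<alpha> (Suc j) \<in> {a..b}"
    using assms by (auto intro: division_in_Icc simp: tagged_partition_def simp del: atLeastAtMost_iff)
  then show ?thesis
    using assms by (force simp: tagged_partition_def)
qed

lemma strict_chain_of_chain:
  fixes x :: "nat \<Rightarrow> real"
  assumes "\<And>j. j < n \<Longrightarrow> x j \<le> x (Suc j)"
  shows "\<exists>m y. division (x 0) (x n) m y \<and>
    (\<Sum>j<m. \<bar>h (y (Suc j)) - h (y j)\<bar> :: real) = (\<Sum>j<n. \<bar>h (x (Suc j)) - h (x j)\<bar>)"
  using assms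
proof (induction n)
  case 0
  have "division (x 0) (x 0) 0 x"
    by (simp add: division_def)
  then show ?case
    by (intro exI[of _ 0]) auto
next
  case (Suc n)
  then obtain m y where y: "division (x 0) (x n) m y"
      "(\<Sum>j<m. \<bar>h (y (Suc j)) - h (y j)\<bar>) = (\<Sum>j<n. \<bar>h (x (Suc j)) - h (x j)\<bar>)"
    by force
  show ?case
  proof (cases "x n = x (Suc n)")
    case True
    then show ?thesis
      using y by (intro exI[of _ m] exI[of _ y]) auto
  next
    case False
    then have less: "x n < x (Suc n)"
      using Suc.prems[of n] by simp
    define y' where "y' = y(Suc m := x (Suc n))"
    have "division (x 0) (x (Suc n)) (Suc m) y'"
      using y(1) less by (auto simp: division_def y'_def less_Suc_eq)
    moreover have "(\<Sum>j<m. \<bar>h (y' (Suc j)) - h (y' j)\<bar>) = (\<Sum>j<m. \<bar>h (y (Suc j)) - h (y j)\<bar>)"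
      by (intro sum.cong) (auto simp: y'_def)
    moreover have "y' (Suc m) = x (Suc n)" "y' m = x n"
      using y(1) by (auto simp: y'_def division_def)
    ultimately show ?thesis
      using y(2) by (intro exI[of _ "Suc m"] exI[of _ y']) simp
  qed
qed

text \<open>The variation bound in real form, for weakly increasing chains. Finiteness matters
  because \<open>enn2real\<close> sends \<infinity> to 0.\<close>

lemma sum_abs_diff_le_total_variation:
  fixes x :: "nat \<Rightarrow> real"
  assumes "total_variation a b h < \<infinity>" "x 0 = a" "x n = b" "\<And>j. j < n \<Longrightarrow> x j \<le> x (Suc j)"
  shows "(\<Sum>j<n. \<bar>h (x (Suc j)) - h (x j)\<bar>) \<le> enn2real (total_variation a b h)"
proof -
  obtain m y where y: "division a b m y"
    "(\<Sum>j<m. \<bar>h (y (Suc j)) - h (y j)\<bar>) = (\<Sum>j<n. \<bar>h (x (Suc j)) - h (x j)\<bar>)"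
    using strict_chain_of_chain[of n x h] assms by auto
  have "ennreal (\<Sum>j<m. \<bar>h (y (Suc j)) - h (y j)\<bar>) \<le> total_variation a b h"
    unfolding total_variation_def by (intro SUP_upper2[of "(m, y)"]) (use y in \<open>auto simp: sum_ennreal\<close>)
  also have "\<dots> = ennreal (enn2real (total_variation a b h))"
    using assms(1) by simp
  finally show ?thesis
    unfolding y(2) by (simp add: ennreal_le_iff)
qed

section \<open>Existence of fine partitions and of divisions through given points\<close>

lemma tagged_partition_concat:
  assumes "tagged_partition a b m \<alpha> \<xi>" "tagged_partition b c n \<beta> \<eta>"
  shows "tagged_partition a c (m + n)
    (\<lambda>i. if i \<le> m then \<alpha> i else \<beta> (i - m)) (\<lambda>i. if i < m then \<xi> i else \<eta> (i - m))"
proof -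
  have "\<alpha> m = \<beta> 0"
    using assms by (auto simp: tagged_partition_def division_def)
  \<comment> \<open>At \<open>i = m\<close> both branches name the same point, so points and tags of
    a subinterval can be split by the same test \<open>j < m\<close>.\<close>
  then have *: "(if i \<le> m then \<alpha> i else \<beta> (i - m)) = (if i < m then \<alpha> i else \<beta> (i - m))" for i
    by auto
  show ?thesis
    unfolding tagged_partition_def division_def
  proof (intro conjI allI impI)
    show "(if 0 \<le> m then \<alpha> 0 else \<beta> (0 - m)) = a"
      using assms by (auto simp: tagged_partition_def division_def)
    show "(if m + n \<le> m then \<alpha> (m + n) else \<beta> (m + n - m)) = c"
      using assms by (auto simp: tagged_partition_def division_def)
  next
    fix j assume "j < m + n"
    then show "(if j \<le> m then \<alpha> j else \<beta> (j - m)) < (if Suc j \<le> m then \<alpha> (Suc j) else \<beta> (Suc j - m))"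
      unfolding *[of j] using assms by (auto simp: tagged_partition_def division_def Suc_diff_le)
  next
    fix j assume "j < m + n"
    then show "(if j < m then \<xi> j else \<eta> (j - m)) \<in>
        {(if j \<le> m then \<alpha> j else \<beta> (j - m))..(if Suc j \<le> m then \<alpha> (Suc j) else \<beta> (Suc j - m))}"
      unfolding *[of j] using assms by (auto simp: tagged_partition_def division_def Suc_diff_le)
  qed
qed

text \<open>By bisection, in the form of \<open>Bolzano\<close>: the property passes to unions of
  adjacent intervals by concatenation, and any interval around \<open>x\<close> shorter than
  \<open>\<delta> x\<close> is fine with the single tag \<open>x\<close>.\<close>

lemma Cousin:
  fixes \<delta> :: "real \<Rightarrow> real"
  assumes "a \<le> b" "\<And>x. x \<in> {a..b} \<Longrightarrow> 0 < \<delta> x"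
  shows "\<exists>\<nu> \<alpha> \<xi>. tagged_partition a b \<nu> \<alpha> \<xi> \<and>
    (\<forall>j<\<nu>. {\<alpha> j..\<alpha> (Suc j)} \<subseteq> {\<xi> j - \<delta> (\<xi> j)..\<xi> j + \<delta> (\<xi> j)})"
  using assms(1)
proof (induction rule: Bolzano)
  case (trans p q r)
  then obtain m \<alpha> \<xi> n \<beta> \<eta> where *: "tagged_partition p q m \<alpha> \<xi>" "tagged_partition q r n \<beta> \<eta>"
    "\<forall>j<m. {\<alpha> j..\<alpha> (Suc j)} \<subseteq> {\<xi> j - \<delta> (\<xi> j)..\<xi> j + \<delta> (\<xi> j)}"
    "\<forall>j<n. {\<beta> j..\<beta> (Suc j)} \<subseteq> {\<eta> j - \<delta> (\<eta> j)..\<eta> j + \<delta> (\<eta> j)}"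
    by blast
  have "\<alpha> m = \<beta> 0"
    using * by (auto simp: tagged_partition_def division_def)
  then have fine: "{(if j \<le> m then \<alpha> j else \<beta> (j - m))..(if Suc j \<le> m then \<alpha> (Suc j) else \<beta> (Suc j - m))}
      \<subseteq> {\<zeta> - \<delta> \<zeta>..\<zeta> + \<delta> \<zeta>}"
    if "j < m + n" "\<zeta> = (if j < m then \<xi> j else \<eta> (j - m))" for j \<zeta>
  proof (cases "j < m")
    case True
    then show ?thesis
      using *(3) that by simp
  next
    case False
    then have "j - m < n" "Suc j - m = Suc (j - m)"
      using that by auto
    then show ?thesis
      using *(4) that False \<open>\<alpha> m = \<beta> 0\<close> by (cases "j = m") (auto simp del: atLeastatMost_subset_iff)
  qed
  show ?case
    by (intro exI conjI allI impI, rule tagged_partition_concat[OF *(1,2)]) (rule fine[OF _ refl])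
next
  case (local x)
  have "\<exists>\<nu> \<alpha> \<xi>. tagged_partition c d \<nu> \<alpha> \<xi> \<and>
      (\<forall>j<\<nu>. {\<alpha> j..\<alpha> (Suc j)} \<subseteq> {\<xi> j - \<delta> (\<xi> j)..\<xi> j + \<delta> (\<xi> j)})"
    if "c \<le> x" "x \<le> d" "d - c < \<delta> x" for c d
  \<comment> \<open>A one-point interval cannot be a subinterval of a division; it receives the
    division with no subintervals.\<close>
  proof (cases "c = d")
    case True
    then show ?thesis
      by (intro exI[of _ 0] exI[of _ "\<lambda>_. c"]) (auto simp: tagged_partition_def division_def)
  next
    case False
    then show ?thesis
      using that
      by (intro exI[of _ 1] exI[of _ "\<lambda>i. if i = 0 then c else d"] exI[of _ "\<lambda>_. x"])
        (auto simp: tagged_partition_def division_def)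
  qed
  then show ?case
    using assms(2)[of x] local by (intro exI[of _ "\<delta> x"] conjI allI impI) simp_all
qed

text \<open>The sorted enumeration of the set with both endpoints added. Applied to the points of
  two divisions it gives a common refinement; applied to the empty set it shows that divisions
  exist.\<close>

lemma division_of_finite_set:
  assumes "a < b" "finite X" "X \<subseteq> {a..b}"
  shows "\<exists>\<nu> \<alpha>. division a b \<nu> \<alpha> \<and> X \<subseteq> \<alpha> ` {..\<nu>}"
proof -
  define xs where "xs = sorted_list_of_set (insert a (insert b X))"
  define \<nu> where "\<nu> = length xs - 1"
  have set: "set xs = insert a (insert b X)" and sorted: "sorted_wrt (<) xs"
    using assms(2) unfolding xs_def by (simp_all only: set_sorted_list_of_set finite_insert strict_sorted_list_of_set)
  then have len: "length xs = Suc \<nu>"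
    by (cases xs) (auto simp: \<nu>_def)
  have mono: "xs ! i < xs ! j" if "i < j" "j \<le> \<nu>" for i j
    using sorted_wrt_nth_less[OF sorted that(1)] that(2) len by simp
  have image: "(!) xs ` {..\<nu>} = set xs"
    unfolding set_conv_nth using len by (auto simp: less_Suc_eq_le)
  have range: "xs ! i \<in> {a..b}" if "i \<le> \<nu>" for i
  proof -
    have "xs ! i \<in> set xs"
      using len that by simp
    then show ?thesis
      using set assms(1,3) by auto
  qed
  \<comment> \<open>These positions must be the first and the last, since an entry before
    \<open>a\<close> or after \<open>b\<close> would leave \<open>{a..b}\<close>.\<close>
  obtain i j where i: "i \<le> \<nu>" "xs ! i = a" and j: "j \<le> \<nu>" "xs ! j = b"
    using image set by (metis atMost_iff imageE insertI1 insertI2)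
  have "xs ! 0 = a"
    using mono[of 0 i] range[of 0] i by (cases "i = 0") auto
  moreover have "xs ! \<nu> = b"
    using mono[of j \<nu>] range[of \<nu>] j by (cases "j = \<nu>") auto
  ultimately have "division a b \<nu> ((!) xs)"
    using mono by (auto simp: division_def)
  then show ?thesis
    using image set by blast
qed

section \<open>Bounds on Riemann-Stieltjes and Young sums\<close>

lemma stieltjes_sum_le_variation_integrator:
  assumes "tagged_partition a b \<nu> \<alpha> \<xi>" "total_variation a b g < \<infinity>"
    and "0 \<le> c" "\<And>x. x \<in> {a..b} \<Longrightarrow> \<bar>h x\<bar> \<le> c"
  shows "\<bar>stieltjes_sum h g \<nu> \<alpha> \<xi>\<bar> \<le> c * enn2real (total_variation a b g)"
proof -
  have "\<bar>stieltjes_sum h g \<nu> \<alpha> \<xi>\<bar> \<le> (\<Sum>j<\<nu>. c * \<bar>g (\<alpha> (Suc j)) - g (\<alpha> j)\<bar>)"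
    unfolding stieltjes_sum_def
    by (intro order_trans[OF sum_abs] sum_mono)
      (use assms(4) tagged_partition_tag_in_Icc[OF assms(1)] in \<open>auto simp: abs_mult intro!: mult_right_mono\<close>)
  also have "\<dots> = c * (\<Sum>j<\<nu>. \<bar>g (\<alpha> (Suc j)) - g (\<alpha> j)\<bar>)"
    by (simp add: sum_distrib_left)
  also have "(\<Sum>j<\<nu>. \<bar>g (\<alpha> (Suc j)) - g (\<alpha> j)\<bar>) \<le> enn2real (total_variation a b g)"
    using assms(1)
    by (intro sum_abs_diff_le_total_variation[OF assms(2)])
      (auto simp: tagged_partition_def division_def less_imp_le)
  finally show ?thesis
    using assms(3) by (simp add: mult_left_mono)
qed

text \<open>Abel summation with \<open>y\<close> running over one index more than \<open>G\<close>:
  \<open>y 0\<close> and \<open>y (Suc n)\<close> are free for the values at the endpoints, while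
  the values between them belong to the tags.\<close>

lemma sum_by_parts:
  fixes y G :: "nat \<Rightarrow> 'a::comm_ring"
  shows "(\<Sum>j<n. y (Suc j) * (G (Suc j) - G j)) =
    y (Suc n) * G n - y 0 * G 0 - (\<Sum>j<Suc n. (y (Suc j) - y j) * G j)"
  by (induction n) (auto simp: algebra_simps)

text \<open>Summation by parts moves the differences onto \<open>h\<close>. With V the variation of
  \<open>h\<close>, the new sum is at most V M, and the boundary terms are at most (\<bar>h a\<bar>
  + V) M and \<bar>h a\<bar> M; together they give the factor 2.\<close>

lemma stieltjes_sum_le_bv_norm_integrand:
  assumes "tagged_partition a b \<nu> \<alpha> \<xi>" "bv_norm a b h < \<infinity>"
    and "\<And>x. x \<in> {a..b} \<Longrightarrow> \<bar>g x\<bar> \<le> M"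
  shows "\<bar>stieltjes_sum h g \<nu> \<alpha> \<xi>\<bar> \<le> 2 * M * enn2real (bv_norm a b h)"
proof -
  have div: "division a b \<nu> \<alpha>"
    using assms(1) by (simp add: tagged_partition_def)
  have finite: "total_variation a b h < \<infinity>"
    using assms(2) by (auto simp: bv_norm_def)
  let ?V = "enn2real (total_variation a b h)"
  have norm: "enn2real (bv_norm a b h) = \<bar>h a\<bar> + ?V"
    using finite by (simp add: bv_norm_def enn2real_plus)
  have ab: "\<alpha> 0 = a" "\<alpha> \<nu> = b"
    using div by (auto simp: division_def)
  have G: "\<bar>g (\<alpha> j)\<bar> \<le> M" if "j \<le> \<nu>" for j
    using division_in_Icc[OF div that] assms(3) by auto
  then have "0 \<le> M"
    by force
  \<comment> \<open>The tags shifted by one index, with \<open>a\<close> in front and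
    \<open>b\<close> behind: a chain of \<open>\<nu> + 2\<close> points.\<close>
  define x where "x j = (if j = 0 then a else if j \<le> \<nu> then \<xi> (j - 1) else b)" for j
  have x: "x j \<le> x (Suc j)" if j: "j < Suc \<nu>" for j
  proof (cases "j = 0")
    case True
    then show ?thesis
      using tagged_partition_tag_in_Icc[OF assms(1), of 0] ab by (auto simp: x_def Suc_le_eq)
  next
    case False
    then obtain i where i: "j = Suc i" "i < \<nu>"
      using j by (cases j) auto
    \<comment> \<open>Consecutive tags are separated by the division point between them.\<close>
    have "\<xi> i \<le> \<alpha> (Suc i)" "Suc i < \<nu> \<Longrightarrow> \<alpha> (Suc i) \<le> \<xi> (Suc i)"
      using assms(1) i by (auto simp: tagged_partition_def)
    then show ?thesis
      using i tagged_partition_tag_in_Icc[OF assms(1), of i] by (auto simp: x_def Suc_le_eq)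
  qed
  have var: "(\<Sum>j<Suc \<nu>. \<bar>h (x (Suc j)) - h (x j)\<bar>) \<le> ?V"
    by (intro sum_abs_diff_le_total_variation[OF finite] x) (auto simp: x_def)
  \<comment> \<open>The chain consisting of \<open>a\<close> and \<open>b\<close> only;
    \<open>division_in_Icc\<close> supplies \<open>a \<le> b\<close>.\<close>
  have "\<bar>h b - h a\<bar> \<le> ?V"
    using sum_abs_diff_le_total_variation[OF finite, of "\<lambda>j. if j = 0 then a else b" 1]
      division_in_Icc[OF div, of 0] ab by auto
  then have hb: "\<bar>h b\<bar> \<le> \<bar>h a\<bar> + ?V"
    by linarith
  have "stieltjes_sum h g \<nu> \<alpha> \<xi> = (\<Sum>j<\<nu>. h (x (Suc j)) * (g (\<alpha> (Suc j)) - g (\<alpha> j)))"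
    unfolding stieltjes_sum_def by (intro sum.cong) (auto simp: x_def)
  also have "\<dots> = h b * g b - h a * g a - (\<Sum>j<Suc \<nu>. (h (x (Suc j)) - h (x j)) * g (\<alpha> j))"
    by (subst sum_by_parts[of "\<lambda>j. h (x j)" "\<lambda>j. g (\<alpha> j)"]) (simp add: x_def ab)
  finally have eq: "stieltjes_sum h g \<nu> \<alpha> \<xi> = \<dots>" .
  have "\<bar>\<Sum>j<Suc \<nu>. (h (x (Suc j)) - h (x j)) * g (\<alpha> j)\<bar> \<le>
      (\<Sum>j<Suc \<nu>. \<bar>h (x (Suc j)) - h (x j)\<bar> * M)"
    by (intro order_trans[OF sum_abs] sum_mono) (auto simp: abs_mult intro!: mult_left_mono G)
  also have "\<dots> \<le> ?V * M"
    unfolding sum_distrib_right[symmetric] by (intro mult_right_mono var \<open>0 \<le> M\<close>)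
  finally have 1: "\<bar>\<Sum>j<Suc \<nu>. (h (x (Suc j)) - h (x j)) * g (\<alpha> j)\<bar> \<le> ?V * M" .
  have 2: "\<bar>h b * g b\<bar> \<le> (\<bar>h a\<bar> + ?V) * M" "\<bar>h a * g a\<bar> \<le> \<bar>h a\<bar> * M"
    unfolding abs_mult using G[of 0] G[of \<nu>] hb ab by (auto intro!: mult_mono)
  show ?thesis
    unfolding eq norm using 1 2 by (simp add: algebra_simps)
qed

section \<open>Young sums as limits of Riemann-Stieltjes sums\<close>

lemma tendsto_right_lim:
  assumes "regulated a b g" "s \<in> {a..<b}"
  shows "((\<lambda>\<tau>. g (s + \<tau>)) \<longlongrightarrow> right_lim g s) (at_right 0)"
proof -
  obtain l where "(g \<longlongrightarrow> l) (at_right s)"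
    using assms unfolding regulated_def by blast
  then have "(g \<longlongrightarrow> right_lim g s) (at_right s)"
    unfolding right_lim_def by (metis tendsto_Lim trivial_limit_at_right_real)
  then show ?thesis
    by (simp add: filterlim_at_right_to_0[of g _ s] add.commute)
qed

lemma tendsto_left_lim:
  assumes "regulated a b g" "t \<in> {a<..b}"
  shows "((\<lambda>\<tau>. g (t - \<tau>)) \<longlongrightarrow> left_lim g t) (at_right 0)"
proof -
  obtain l where "(g \<longlongrightarrow> l) (at_left t)"
    using assms unfolding regulated_def by blast
  then have "(g \<longlongrightarrow> left_lim g t) (at_left t)"
    unfolding left_lim_def by (metis tendsto_Lim trivial_limit_at_left_real)
  then show ?thesis
    by (simp add: filterlim_at_left_to_right filterlim_at_right_to_0[of _ _ "- t"])
qed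

text \<open>Built so that a Young sum becomes a limit of Stieltjes sums as \<tau> tends to 0 from
  the right. Each subinterval yields three pieces, and with the tags of \<open>young_tags\<close>
  they produce the right jump, the middle term and the left jump. A single \<tau> serves all
  subintervals, so only one limit is taken.\<close>

definition young_division :: "(nat \<Rightarrow> real) \<Rightarrow> real \<Rightarrow> nat \<Rightarrow> real" where
  "young_division \<alpha> \<tau> i = (let j = i div 3 in
     if i mod 3 = 0 then \<alpha> j else if i mod 3 = 1 then \<alpha> j + \<tau> else \<alpha> (Suc j) - \<tau>)"

definition young_tags :: "(nat \<Rightarrow> real) \<Rightarrow> (nat \<Rightarrow> real) \<Rightarrow> nat \<Rightarrow> real" where
  "young_tags \<alpha> \<xi> i = (let j = i div 3 in
     if i mod 3 = 0 then \<alpha> j else if i mod 3 = 1 then \<xi> j else \<alpha> (Suc j))"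

lemma young_division_simps [simp]:
  "young_division \<alpha> \<tau> (3 * j) = \<alpha> j"
  "young_division \<alpha> \<tau> (Suc (3 * j)) = \<alpha> j + \<tau>"
  "young_division \<alpha> \<tau> (Suc (Suc (3 * j))) = \<alpha> (Suc j) - \<tau>"
  "young_division \<alpha> \<tau> (Suc (Suc (Suc (3 * j)))) = \<alpha> (Suc j)"
proof -
  have "Suc (3 * j) div 3 = j" "Suc (3 * j) mod 3 = 1"
    "Suc (Suc (3 * j)) div 3 = j" "Suc (Suc (3 * j)) mod 3 = 2"
    "Suc (Suc (Suc (3 * j))) div 3 = Suc j" "Suc (Suc (Suc (3 * j))) mod 3 = 0"
    by presburger+
  then show "young_division \<alpha> \<tau> (3 * j) = \<alpha> j"
    "young_division \<alpha> \<tau> (Suc (3 * j)) = \<alpha> j + \<tau>"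
    "young_division \<alpha> \<tau> (Suc (Suc (3 * j))) = \<alpha> (Suc j) - \<tau>"
    "young_division \<alpha> \<tau> (Suc (Suc (Suc (3 * j)))) = \<alpha> (Suc j)"
    by (simp_all add: young_division_def Let_def)
qed

lemma young_tags_simps [simp]:
  "young_tags \<alpha> \<xi> (3 * j) = \<alpha> j"
  "young_tags \<alpha> \<xi> (Suc (3 * j)) = \<xi> j"
  "young_tags \<alpha> \<xi> (Suc (Suc (3 * j))) = \<alpha> (Suc j)"
proof -
  have "Suc (3 * j) div 3 = j" "Suc (3 * j) mod 3 = 1"
    "Suc (Suc (3 * j)) div 3 = j" "Suc (Suc (3 * j)) mod 3 = 2"
    by presburger+
  then show "young_tags \<alpha> \<xi> (3 * j) = \<alpha> j" "young_tags \<alpha> \<xi> (Suc (3 * j)) = \<xi> j"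
    "young_tags \<alpha> \<xi> (Suc (Suc (3 * j))) = \<alpha> (Suc j)"
    by (simp_all add: young_tags_def Let_def)
qed

text \<open>The condition on the tags also keeps the two cuts of a subinterval in order:
  \<open>\<alpha> j + \<tau> < \<alpha> (Suc j) - \<tau>\<close>.\<close>

lemma tagged_partition_young:
  assumes "division a b \<nu> \<alpha>" "0 < \<tau>"
    and tags: "\<And>j. j < \<nu> \<Longrightarrow> \<alpha> j + \<tau> < \<xi> j \<and> \<xi> j < \<alpha> (Suc j) - \<tau>"
  shows "tagged_partition a b (3 * \<nu>) (young_division \<alpha> \<tau>) (young_tags \<alpha> \<xi>)"
proof -
  have "young_division \<alpha> \<tau> i < young_division \<alpha> \<tau> (Suc i) \<and>
      young_tags \<alpha> \<xi> i \<in> {young_division \<alpha> \<tau> i..young_division \<alpha> \<tau> (Suc i)}" if "i < 3 * \<nu>" for i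
  proof -
    have "i = 3 * (i div 3) \<or> i = Suc (3 * (i div 3)) \<or> i = Suc (Suc (3 * (i div 3)))" "i div 3 < \<nu>"
      using that by presburger+
    then obtain j where "i = 3 * j \<or> i = Suc (3 * j) \<or> i = Suc (Suc (3 * j))" "j < \<nu>"
      by blast
    then show ?thesis
      using tags[of j] assms(2) by auto
  qed
  moreover have "young_division \<alpha> \<tau> 0 = a"
    using assms(1) young_division_simps(1)[of \<alpha> \<tau> 0] by (simp add: division_def)
  ultimately show ?thesis
    using assms(1) by (simp add: tagged_partition_def division_def)
qed

lemma sum_group_3:
  fixes F :: "nat \<Rightarrow> 'a::comm_monoid_add"
  shows "(\<Sum>i<3 * n. F i) = (\<Sum>j<n. F (3 * j) + F (Suc (3 * j)) + F (Suc (Suc (3 * j))))"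
proof (induction n)
  case (Suc n)
  have "3 * Suc n = Suc (Suc (Suc (3 * n)))"
    by simp
  then show ?case
    by (simp only: Suc.IH sum.lessThan_Suc add.assoc)
qed simp

text \<open>The tags stay fixed as \<tau> shrinks; only values of \<open>g\<close> move, and they
  converge to its one-sided limits because \<open>g\<close> is regulated.\<close>

lemma stieltjes_sum_tendsto_young_sum:
  assumes "regulated a b g" "division a b \<nu> \<alpha>"
  shows "((\<lambda>\<tau>. stieltjes_sum f g (3 * \<nu>) (young_division \<alpha> \<tau>) (young_tags \<alpha> \<xi>))
    \<longlongrightarrow> young_sum f g \<nu> \<alpha> \<xi>) (at_right 0)"
proof -
  have "\<alpha> j \<in> {a..<b}" "\<alpha> (Suc j) \<in> {a<..b}" if "j < \<nu>" for j
    using division_in_Icc[OF assms(2), of j] division_in_Icc[OF assms(2), of "Suc j"]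
      division_less[OF assms(2), of j "Suc j"] that by auto
  then have lims: "((\<lambda>\<tau>. g (\<alpha> j + \<tau>)) \<longlongrightarrow> right_lim g (\<alpha> j)) (at_right 0)"
      "((\<lambda>\<tau>. g (\<alpha> (Suc j) - \<tau>)) \<longlongrightarrow> left_lim g (\<alpha> (Suc j))) (at_right 0)" if "j < \<nu>" for j
    using that tendsto_right_lim[OF assms(1)] tendsto_left_lim[OF assms(1)] by blast+
  show ?thesis
    unfolding stieltjes_sum_def young_sum_def sum_group_3 right_jump_def left_jump_def
    by (simp, intro tendsto_sum tendsto_intros) (auto intro: lims)
qed

text \<open>A weak bound survives the limit in \<tau>. Strictness of the tags makes the cuts
  admissible for all small \<tau>, uniformly over the finitely many subintervals.\<close>

lemma young_sum_le:
  assumes "regulated a b g" "division a b \<nu> \<alpha>" "\<And>j. j < \<nu> \<Longrightarrow> \<alpha> j < \<xi> j \<and> \<xi> j < \<alpha> (Suc j)"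
    and bound: "\<And>\<nu> \<alpha> \<xi>. tagged_partition a b \<nu> \<alpha> \<xi> \<Longrightarrow> \<bar>stieltjes_sum f g \<nu> \<alpha> \<xi>\<bar> \<le> C"
  shows "\<bar>young_sum f g \<nu> \<alpha> \<xi>\<bar> \<le> C"
proof (rule tendsto_upperbound)
  show "((\<lambda>\<tau>. \<bar>stieltjes_sum f g (3 * \<nu>) (young_division \<alpha> \<tau>) (young_tags \<alpha> \<xi>)\<bar>)
      \<longlongrightarrow> \<bar>young_sum f g \<nu> \<alpha> \<xi>\<bar>) (at_right 0)"
    by (intro tendsto_rabs stieltjes_sum_tendsto_young_sum[OF assms(1,2)])
  have "\<forall>\<^sub>F \<tau> in at_right 0. \<alpha> j + \<tau> < \<xi> j \<and> \<xi> j < \<alpha> (Suc j) - \<tau>" if "j < \<nu>" for j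
  proof -
    have "\<forall>\<^sub>F \<tau> in at_right 0. \<tau> < min (\<xi> j - \<alpha> j) (\<alpha> (Suc j) - \<xi> j)"
      using assms(3)[OF that] by (intro order_tendstoD(2)[OF tendsto_ident_at]) auto
    then show ?thesis
      by eventually_elim auto
  qed
  then have "\<forall>\<^sub>F \<tau> in at_right 0. \<forall>j\<in>{..<\<nu>}. \<alpha> j + \<tau> < \<xi> j \<and> \<xi> j < \<alpha> (Suc j) - \<tau>"
    by (intro eventually_ball_finite) auto
  with eventually_at_right_less[of "0::real"]
  show "\<forall>\<^sub>F \<tau> in at_right 0.
      \<bar>stieltjes_sum f g (3 * \<nu>) (young_division \<alpha> \<tau>) (young_tags \<alpha> \<xi>)\<bar> \<le> C"
    by eventually_elim (intro bound tagged_partition_young[OF assms(2)]; simp)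
qed simp

section \<open>The integrals as limits along filters of partitions\<close>

type_synonym tagged_division = "nat \<times> (nat \<Rightarrow> real) \<times> (nat \<Rightarrow> real)"

definition fine_partitions :: "real \<Rightarrow> real \<Rightarrow> (real \<Rightarrow> real) \<Rightarrow> tagged_division set" where
  "fine_partitions a b \<delta> = {(\<nu>, \<alpha>, \<xi>). tagged_partition a b \<nu> \<alpha> \<xi> \<and>
     (\<forall>j<\<nu>. {\<alpha> j..\<alpha> (Suc j)} \<subseteq> {\<xi> j - \<delta> (\<xi> j)..\<xi> j + \<delta> (\<xi> j)})}"

definition refining_partitions :: "real \<Rightarrow> real \<Rightarrow> nat \<times> (nat \<Rightarrow> real) \<Rightarrow> tagged_division set" where
  "refining_partitions a b = (\<lambda>(\<mu>, \<beta>). {(\<nu>, \<alpha>, \<xi>). tagged_partition a b \<nu> \<alpha> \<xi> \<and>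
     \<beta> ` {..\<mu>} \<subseteq> \<alpha> ` {..\<nu>} \<and> (\<forall>j<\<nu>. \<alpha> j < \<xi> j \<and> \<xi> j < \<alpha> (Suc j))})"

text \<open>As filters, the two notions of a sufficiently fine partition turn the
  epsilon-definitions of the integrals into \<open>tendsto\<close>, so that general results on
  uniform limits apply.\<close>

definition gauge_filter :: "real \<Rightarrow> real \<Rightarrow> tagged_division filter" where
  "gauge_filter a b =
     (INF \<delta>\<in>{\<delta>. \<forall>x\<in>{a..b}. \<delta> x \<in> {0<..<1}}. principal (fine_partitions a b \<delta>))"

definition refinement_filter :: "real \<Rightarrow> real \<Rightarrow> tagged_division filter" where
  "refinement_filter a b =
     (INF p\<in>{(\<mu>, \<beta>). division a b \<mu> \<beta>}. principal (refining_partitions a b p))"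

text \<open>The pointwise minimum of two gauges refines both, so the family is directed and the
  infimum is governed by single gauges.\<close>

lemma eventually_gauge_filter:
  "eventually P (gauge_filter a b) \<longleftrightarrow>
    (\<exists>\<delta>. (\<forall>x\<in>{a..b}. \<delta> x \<in> {0<..<1}) \<and> (\<forall>p\<in>fine_partitions a b \<delta>. P p))"
proof -
  have "eventually P (gauge_filter a b) \<longleftrightarrow> (\<exists>\<delta>\<in>{\<delta>. \<forall>x\<in>{a..b}. \<delta> x \<in> {0<..<1}}.
      eventually P (principal (fine_partitions a b \<delta>)))"
    unfolding gauge_filter_def
  proof (rule eventually_INF_base)
    show "{\<delta> :: real \<Rightarrow> real. \<forall>x\<in>{a..b}. \<delta> x \<in> {0<..<1}} \<noteq> {}"
      by (auto intro!: exI[of _ "\<lambda>_. 1 / 2"])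
  next
    fix \<delta> \<delta>' :: "real \<Rightarrow> real"
    assume "\<delta> \<in> {\<delta>. \<forall>x\<in>{a..b}. \<delta> x \<in> {0<..<1}}" "\<delta>' \<in> {\<delta>. \<forall>x\<in>{a..b}. \<delta> x \<in> {0<..<1}}"
    moreover have "fine_partitions a b (\<lambda>x. min (\<delta> x) (\<delta>' x)) \<subseteq>
        fine_partitions a b \<delta> \<inter> fine_partitions a b \<delta>'"
      unfolding fine_partitions_def by fastforce
    ultimately show "\<exists>\<eta>\<in>{\<delta>. \<forall>x\<in>{a..b}. \<delta> x \<in> {0<..<1}}. principal (fine_partitions a b \<eta>) \<le>
        inf (principal (fine_partitions a b \<delta>)) (principal (fine_partitions a b \<delta>'))"
      by (intro bexI[of _ "\<lambda>x. min (\<delta> x) (\<delta>' x)"]) auto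
  qed
  then show ?thesis
    by (simp add: eventually_principal)
qed

text \<open>Directedness comes here from a division through the points of two given ones.\<close>

lemma eventually_refinement_filter:
  assumes "a < b"
  shows "eventually P (refinement_filter a b) \<longleftrightarrow>
    (\<exists>\<mu> \<beta>. division a b \<mu> \<beta> \<and> (\<forall>p\<in>refining_partitions a b (\<mu>, \<beta>). P p))"
proof -
  have "eventually P (refinement_filter a b) \<longleftrightarrow> (\<exists>p\<in>{(\<mu>, \<beta>). division a b \<mu> \<beta>}.
      eventually P (principal (refining_partitions a b p)))"
    unfolding refinement_filter_def
  proof (rule eventually_INF_base)
    show "{(\<mu>, \<beta>). division a b \<mu> \<beta>} \<noteq> {}"
      using division_of_finite_set[OF assms, of "{}"] by auto
  next
    fix p q assume "p \<in> {(\<mu>, \<beta>). division a b \<mu> \<beta>}" "q \<in> {(\<mu>, \<beta>). division a b \<mu> \<beta>}"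
    then obtain m \<beta> n \<gamma> where p: "p = (m, \<beta>)" "division a b m \<beta>" and q: "q = (n, \<gamma>)" "division a b n \<gamma>"
      by auto
    have "\<beta> ` {..m} \<union> \<gamma> ` {..n} \<subseteq> {a..b}"
      using division_in_Icc[OF p(2)] division_in_Icc[OF q(2)] by blast
    then obtain \<nu> \<alpha> where \<alpha>: "division a b \<nu> \<alpha>" "\<beta> ` {..m} \<union> \<gamma> ` {..n} \<subseteq> \<alpha> ` {..\<nu>}"
      using division_of_finite_set[OF assms, of "\<beta> ` {..m} \<union> \<gamma> ` {..n}"] by auto
    then have "refining_partitions a b (\<nu>, \<alpha>) \<subseteq> refining_partitions a b p \<inter> refining_partitions a b q"
      unfolding refining_partitions_def p q by (clarsimp, blast)
    with \<alpha>(1) show "\<exists>r\<in>{(\<mu>, \<beta>). division a b \<mu> \<beta>}. principal (refining_partitions a b r) \<le>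
        inf (principal (refining_partitions a b p)) (principal (refining_partitions a b q))"
      by (intro bexI[of _ "(\<nu>, \<alpha>)"]) auto
  qed
  then show ?thesis
    by (simp add: eventually_principal)
qed

text \<open>This is the content of Cousin's lemma; properness of the filter is what makes the
  integral unique.\<close>

lemma gauge_filter_neq_bot:
  assumes "a \<le> b"
  shows "gauge_filter a b \<noteq> bot"
proof -
  have "fine_partitions a b \<delta> \<noteq> {}" if \<delta>: "\<forall>x\<in>{a..b}. \<delta> x \<in> {0<..<1}" for \<delta>
  proof -
    obtain \<nu> \<alpha> \<xi> where "tagged_partition a b \<nu> \<alpha> \<xi>"
      "\<forall>j<\<nu>. {\<alpha> j..\<alpha> (Suc j)} \<subseteq> {\<xi> j - \<delta> (\<xi> j)..\<xi> j + \<delta> (\<xi> j)}"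
      using Cousin[OF assms, of \<delta>] \<delta> by force
    then have "(\<nu>, \<alpha>, \<xi>) \<in> fine_partitions a b \<delta>"
      by (simp add: fine_partitions_def)
    then show ?thesis
      by blast
  qed
  then show ?thesis
    unfolding trivial_limit_def eventually_gauge_filter by blast
qed

lemma refinement_filter_neq_bot:
  assumes "a < b"
  shows "refinement_filter a b \<noteq> bot"
proof -
  \<comment> \<open>Every division refines itself, and midpoints are strictly interior tags.\<close>
  have "(\<mu>, \<beta>, \<lambda>j. (\<beta> j + \<beta> (Suc j)) / 2) \<in> refining_partitions a b (\<mu>, \<beta>)"
    if "division a b \<mu> \<beta>" for \<mu> \<beta>
    using that by (auto simp: refining_partitions_def tagged_partition_def division_def less_imp_le)
  then show ?thesis
    unfolding trivial_limit_def eventually_refinement_filter[OF assms] by blast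
qed

fun partition_filter :: "integral_kind \<Rightarrow> real \<Rightarrow> real \<Rightarrow> tagged_division filter" where
  "partition_filter Kurzweil a b = gauge_filter a b"
| "partition_filter Young a b = refinement_filter a b"
| "partition_filter Dushnik a b = refinement_filter a b"

fun integral_sum ::
    "integral_kind \<Rightarrow> (real \<Rightarrow> real) \<Rightarrow> (real \<Rightarrow> real) \<Rightarrow> tagged_division \<Rightarrow> real" where
  "integral_sum Kurzweil f g (\<nu>, \<alpha>, \<xi>) = stieltjes_sum f g \<nu> \<alpha> \<xi>"
| "integral_sum Young f g (\<nu>, \<alpha>, \<xi>) = young_sum f g \<nu> \<alpha> \<xi>"
| "integral_sum Dushnik f g (\<nu>, \<alpha>, \<xi>) = stieltjes_sum f g \<nu> \<alpha> \<xi>"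

text \<open>The sets over which convergence of the sums will be uniform. Outside the Kurzweil case
  the tags are strictly interior, as \<open>young_sum_le\<close> requires.\<close>

fun admissible_partitions :: "integral_kind \<Rightarrow> real \<Rightarrow> real \<Rightarrow> tagged_division set" where
  "admissible_partitions Kurzweil a b = {(\<nu>, \<alpha>, \<xi>). tagged_partition a b \<nu> \<alpha> \<xi>}"
| "admissible_partitions _ a b =
     {(\<nu>, \<alpha>, \<xi>). tagged_partition a b \<nu> \<alpha> \<xi> \<and> (\<forall>j<\<nu>. \<alpha> j < \<xi> j \<and> \<xi> j < \<alpha> (Suc j))}"

lemma partition_filter_neq_bot: "a < b \<Longrightarrow> partition_filter k a b \<noteq> bot"
  by (cases k) (simp_all add: gauge_filter_neq_bot refinement_filter_neq_bot)

lemma eventually_admissible_partitions: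
  assumes "a < b"
  shows "\<forall>\<^sub>F p in partition_filter k a b. p \<in> admissible_partitions k a b"
proof -
  have "\<forall>\<^sub>F p in gauge_filter a b. p \<in> admissible_partitions Kurzweil a b"
    unfolding eventually_gauge_filter
    by (intro exI[of _ "\<lambda>_. 1 / 2"]) (auto simp: fine_partitions_def)
  moreover have "\<forall>\<^sub>F p in refinement_filter a b. p \<in> admissible_partitions Dushnik a b"
    unfolding eventually_refinement_filter[OF assms]
    using division_of_finite_set[OF assms, of "{}"] by (auto simp: refining_partitions_def)
  ultimately show ?thesis
    by (cases k) auto
qed

lemma has_stieltjes_integral_iff_tendsto:
  assumes "a < b"
  shows "has_stieltjes_integral k f g a b I \<longleftrightarrow>
    (k = Young \<longrightarrow> regulated a b g) \<and> (integral_sum k f g \<longlongrightarrow> I) (partition_filter k a b)"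
proof (cases k)
  case Kurzweil
  then show ?thesis
    by (simp add: has_kurzweil_integral_def tendsto_iff eventually_gauge_filter fine_partitions_def
        dist_real_def)
next
  case Young
  then show ?thesis
    by (simp add: has_young_integral_def tendsto_iff eventually_refinement_filter[OF assms]
        refining_partitions_def dist_real_def)
next
  case Dushnik
  then show ?thesis
    by (simp add: has_dushnik_integral_def tendsto_iff eventually_refinement_filter[OF assms]
        refining_partitions_def dist_real_def)
qed

lemma stieltjes_integral_eqI:
  assumes "a < b" "has_stieltjes_integral k f g a b I"
  shows "stieltjes_integral k f g a b = I"
  unfolding stieltjes_integral_def
  using assms tendsto_unique[OF partition_filter_neq_bot[OF assms(1)]]
  by (intro the_equality) (auto simp: has_stieltjes_integral_iff_tendsto)

section \<open>Interchange of limits\<close>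

text \<open>The Moore-Osgood argument: uniform closeness of \<open>s m\<close> and
  \<open>s n\<close> on \<open>S\<close> passes to their limits along \<open>F\<close>, so
  \<open>I\<close> is Cauchy; completeness gives \<open>l\<close>, and
  \<open>swap_uniform_limit'\<close> transfers it to \<open>t\<close>.\<close>

lemma uniform_limit_tendsto_interchange:
  fixes s :: "nat \<Rightarrow> 'p \<Rightarrow> 'a::banach"
  assumes "\<And>n. (s n \<longlongrightarrow> I n) F" "F \<noteq> bot" "uniform_limit S s t sequentially" "\<forall>\<^sub>F p in F. p \<in> S"
  obtains l where "I \<longlonglongrightarrow> l" "(t \<longlongrightarrow> l) F"
proof -
  have "Cauchy I"
  proof (rule metric_CauchyI)
    fix e :: real assume "0 < e"
    \<comment> \<open>Two distances below e/4 add up to at most e/2; the limit preserves only the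
      weak inequality, and e/2 still lies below e.\<close>
    then have "\<forall>\<^sub>F n in sequentially. \<forall>p\<in>S. dist (s n p) (t p) < e / 4"
      using uniform_limitD[OF assms(3), of "e / 4"] by simp
    then obtain N where N: "\<And>n p. n \<ge> N \<Longrightarrow> p \<in> S \<Longrightarrow> dist (s n p) (t p) < e / 4"
      by (auto simp: eventually_sequentially)
    have "dist (I m) (I n) < e" if "m \<ge> N" "n \<ge> N" for m n
    proof -
      have "\<forall>\<^sub>F p in F. dist (s m p) (s n p) \<le> e / 2"
        using assms(4)
      proof eventually_elim
        case (elim p)
        then show ?case
          using N[OF that(1) elim] N[OF that(2) elim] dist_triangle2[of "s m p" "s n p" "t p"] by simp
      qed
      then have "dist (I m) (I n) \<le> e / 2"
        by (intro tendsto_upperbound[OF tendsto_dist[OF assms(1) assms(1)] _ assms(2)])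
      with \<open>0 < e\<close> show ?thesis
        by simp
    qed
    then show "\<exists>N. \<forall>m\<ge>N. \<forall>n\<ge>N. dist (I m) (I n) < e"
      by blast
  qed
  then obtain l where "I \<longlonglongrightarrow> l"
    using Cauchy_convergent convergent_def by blast
  moreover from this have "(t \<longlongrightarrow> l) F"
    by (intro swap_uniform_limit'[OF _ _ assms(3,4)]) (auto simp: assms(1))
  ultimately show thesis
    by (rule that)
qed

lemma integral_sum_diff:
  "integral_sum k f g p - integral_sum k h g p = integral_sum k (\<lambda>x. f x - h x) g p"
  by (cases k; cases p)
    (simp_all add: stieltjes_sum_def young_sum_def sum_subtractf[symmetric] algebra_simps)

text \<open>Reduces all three integrals to one estimate on Stieltjes sums.\<close>

lemma integral_sum_le:
  assumes "k = Young \<longrightarrow> regulated a b g" "p \<in> admissible_partitions k a b"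
    and "\<And>\<nu> \<alpha> \<xi>. tagged_partition a b \<nu> \<alpha> \<xi> \<Longrightarrow> \<bar>stieltjes_sum f g \<nu> \<alpha> \<xi>\<bar> \<le> C"
  shows "\<bar>integral_sum k f g p\<bar> \<le> C"
  using assms by (cases k; cases p) (auto simp: tagged_partition_def intro!: young_sum_le)

lemma uniform_limit_integral_sum:
  assumes "k = Young \<longrightarrow> regulated a b g"
    and small: "\<And>e. 0 < e \<Longrightarrow> \<forall>\<^sub>F n in sequentially. \<forall>\<nu> \<alpha> \<xi>. tagged_partition a b \<nu> \<alpha> \<xi> \<longrightarrow>
      \<bar>stieltjes_sum (\<lambda>x. fn n x - f x) g \<nu> \<alpha> \<xi>\<bar> \<le> e"
  shows "uniform_limit (admissible_partitions k a b)
    (\<lambda>n. integral_sum k (fn n) g) (integral_sum k f g) sequentially"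
proof (rule uniform_limitI)
  fix e :: real assume "0 < e"
  \<comment> \<open>Halving turns the weak bound of \<open>small\<close> into the strict one that
    uniform convergence asks for.\<close>
  then have "0 < e / 2"
    by simp
  from small[OF this]
  show "\<forall>\<^sub>F n in sequentially. \<forall>p\<in>admissible_partitions k a b.
      dist (integral_sum k (fn n) g p) (integral_sum k f g p) < e"
  proof eventually_elim
    case (elim n)
    have "\<bar>integral_sum k (\<lambda>x. fn n x - f x) g p\<bar> \<le> e / 2" if "p \<in> admissible_partitions k a b" for p
      using elim by (intro integral_sum_le[OF assms(1) that]) blast
    then show ?case
      using \<open>0 < e\<close> by (fastforce simp: dist_real_def integral_sum_diff)
  qed
qed

lemma eventually_stieltjes_sum_le:
  assumes "(total_variation a b g < \<infinity> \<and> uniform_limit {a..b} fn f sequentially) \<or>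
      (bounded (g ` {a..b}) \<and> (\<lambda>n. bv_norm a b (\<lambda>x. fn n x - f x)) \<longlonglongrightarrow> 0)"
    and "0 < e"
  shows "\<forall>\<^sub>F n in sequentially. \<forall>\<nu> \<alpha> \<xi>. tagged_partition a b \<nu> \<alpha> \<xi> \<longrightarrow>
    \<bar>stieltjes_sum (\<lambda>x. fn n x - f x) g \<nu> \<alpha> \<xi>\<bar> \<le> e"
  using assms(1)
proof
  assume *: "total_variation a b g < \<infinity> \<and> uniform_limit {a..b} fn f sequentially"
  define V where "V = enn2real (total_variation a b g)"
  \<comment> \<open>The added 1 keeps the denominator positive when \<open>g\<close> has variation
    0.\<close>
  define c where "c = e / (V + 1)"
  have V: "0 \<le> V"
    by (simp add: V_def)
  then have c: "0 < c" "c * V \<le> e"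
    using \<open>0 < e\<close> by (auto simp: c_def field_simps)
  have "\<forall>\<^sub>F n in sequentially. \<forall>x\<in>{a..b}. dist (fn n x) (f x) < c"
    using * c by (auto intro: uniform_limitD)
  then show ?thesis
  proof eventually_elim
    case (elim n)
    then have "\<bar>fn n x - f x\<bar> \<le> c" if "x \<in> {a..b}" for x
      using that by (force simp: dist_real_def)
    then have "\<bar>stieltjes_sum (\<lambda>x. fn n x - f x) g \<nu> \<alpha> \<xi>\<bar> \<le> c * V"
      if "tagged_partition a b \<nu> \<alpha> \<xi>" for \<nu> \<alpha> \<xi>
      unfolding V_def using stieltjes_sum_le_variation_integrator[OF that] * c by auto
    with c show ?case
      by force
  qed
next
  assume *: "bounded (g ` {a..b}) \<and> (\<lambda>n. bv_norm a b (\<lambda>x. fn n x - f x)) \<longlonglongrightarrow> 0"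
  then obtain M where M: "0 < M" "\<And>x. x \<in> {a..b} \<Longrightarrow> \<bar>g x\<bar> \<le> M"
    by (auto simp: bounded_pos)
  \<comment> \<open>The threshold cancels the factor \<open>2 * M\<close> of the bound. Being
    finite, it also forces the norm to be finite for these \<open>n\<close>, as that bound
    requires.\<close>
  have "\<forall>\<^sub>F n in sequentially. bv_norm a b (\<lambda>x. fn n x - f x) < ennreal (e / (2 * M))"
    using * M(1) \<open>0 < e\<close> by (intro order_tendstoD(2)[of _ 0]) auto
  then show ?thesis
  proof eventually_elim
    case (elim n)
    let ?B = "bv_norm a b (\<lambda>x. fn n x - f x)"
    have fin: "?B < \<infinity>"
      using elim by (rule less_trans) simp
    have "enn2real ?B \<le> e / (2 * M)"
      using elim M(1) \<open>0 < e\<close> by (intro enn2real_leI) auto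
    then have "2 * M * enn2real ?B \<le> e"
      using M(1) by (simp add: field_simps)
    then show ?case
      using stieltjes_sum_le_bv_norm_integrand[OF _ fin M(2)] by force
  qed
qed

theorem theorem2p4:
  fixes a b :: real
    and f g :: "real \<Rightarrow> real"
    and fn :: "nat \<Rightarrow> real \<Rightarrow> real"
    and k :: integral_kind
  assumes "a < b"
    and "\<And>n. stieltjes_integrable k (fn n) g a b"
    and "(total_variation a b g < \<infinity> \<and> uniform_limit {a..b} fn f sequentially) \<or>
         (bounded (g ` {a..b}) \<and> (\<lambda>n. bv_norm a b (\<lambda>x. fn n x - f x)) \<longlonglongrightarrow> 0)"
  shows "stieltjes_integrable k f g a b \<and>
         (\<lambda>n. stieltjes_integral k (fn n) g a b) \<longlonglongrightarrow> stieltjes_integral k f g a b"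
proof -
  have has: "has_stieltjes_integral k (fn n) g a b (stieltjes_integral k (fn n) g a b)" for n
    using assms(2)[of n] stieltjes_integral_eqI[OF assms(1)] by (auto simp: stieltjes_integrable_def)
  \<comment> \<open>For the Young integral, regularity of \<open>g\<close> is read off from the
    existence of the integrals of \<open>fn n\<close>.\<close>
  then have reg: "k = Young \<longrightarrow> regulated a b g"
    and lim: "(integral_sum k (fn n) g \<longlongrightarrow> stieltjes_integral k (fn n) g a b) (partition_filter k a b)" for n
    by (simp_all add: has_stieltjes_integral_iff_tendsto[OF assms(1)])
  \<comment> \<open>The interchange gives convergence of the sums for \<open>f\<close> and of the
    integrals to the same \<open>l\<close>, hence existence and value of the limit integral at
    once.\<close>
  obtain l where l: "(\<lambda>n. stieltjes_integral k (fn n) g a b) \<longlonglongrightarrow> l"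
      "(integral_sum k f g \<longlongrightarrow> l) (partition_filter k a b)"
    using uniform_limit_tendsto_interchange[OF lim partition_filter_neq_bot[OF assms(1)]
        uniform_limit_integral_sum[OF reg eventually_stieltjes_sum_le[OF assms(3)]]
        eventually_admissible_partitions[OF assms(1)]]
    by blast
  with reg have "has_stieltjes_integral k f g a b l"
    by (simp add: has_stieltjes_integral_iff_tendsto[OF assms(1)])
  with l(1) stieltjes_integral_eqI[OF assms(1) this] show ?thesis
    by (auto simp: stieltjes_integrable_def)
qed

end
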